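(* A set of power $3$ is colimit-dense in $\mathbf{Set}^{\mathrm{op}}$. That is, the full subcategory of $\mathbf{Set}^{\mathrm{op}}$ on a single three-element set is colimit-dense in $\mathbf{Set}^{\mathrm{op}}$.
   Context: $\mathbf{Set}$ is the category of sets and functions. A small, full subcategory $\mathcal{G}$ of a category $\mathcal{K}$ is called colimit-dense if every object of $\mathcal{K}$ is a colimit (in $\mathcal{K}$) of some small diagram in $\mathcal{G}$. (Colimits in $\mathbf{Set}^{\mathrm{op}}$ are limits in $\mathbf{Set}$.) *)

theory Defs
  imports Main "HOL-Library.FuncSet" "HOL-Library.Equipollence"
begin

record ('o, 'm) category =
  Obj :: "'o set"
  Arr :: "'m set"
  Dom :: "'m \<Rightarrow> 'o"
  Cod :: "'m \<Rightarrow> 'o"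
  Id :: "'o \<Rightarrow> 'm"
  Comp :: "'m \<Rightarrow> 'm \<Rightarrow> 'm"

definition hom :: "('o, 'm) category \<Rightarrow> 'o \<Rightarrow> 'o \<Rightarrow> 'm set" where
  "hom C a b = {f \<in> Arr C. Dom C f = a \<and> Cod C f = b}"

text \<open>Composition is written in applicative order: \<open>Comp C g f\<close> is \<open>g\<close> after \<open>f\<close>.
  Values of the operations outside objects, arrows and composable pairs are irrelevant.\<close>

definition is_category :: "('o, 'm) category \<Rightarrow> bool" where
  "is_category C \<longleftrightarrow>
     (\<forall>f\<in>Arr C. Dom C f \<in> Obj C \<and> Cod C f \<in> Obj C) \<and>
     (\<forall>a\<in>Obj C. Id C a \<in> hom C a a) \<and>
     (\<forall>f\<in>Arr C. \<forall>g\<in>Arr C. Dom C g = Cod C f \<longrightarrow>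
        Comp C g f \<in> hom C (Dom C f) (Cod C g)) \<and>
     (\<forall>f\<in>Arr C. Comp C f (Id C (Dom C f)) = f \<and> Comp C (Id C (Cod C f)) f = f) \<and>
     (\<forall>f\<in>Arr C. \<forall>g\<in>Arr C. \<forall>h\<in>Arr C. Dom C g = Cod C f \<and> Dom C h = Cod C g \<longrightarrow>
        Comp C h (Comp C g f) = Comp C (Comp C h g) f)"

definition op_cat :: "('o, 'm) category \<Rightarrow> ('o, 'm) category" where
  "op_cat C = C\<lparr>Dom := Cod C, Cod := Dom C, Comp := (\<lambda>g f. Comp C f g)\<rparr>"

definition full_subcat :: "('o, 'm) category \<Rightarrow> 'o set \<Rightarrow> ('o, 'm) category" where
  "full_subcat C G = C\<lparr>Obj := G, Arr := {f \<in> Arr C. Dom C f \<in> G \<and> Cod C f \<in> G}\<rparr>"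

definition is_functor ::
  "('i, 'k) category \<Rightarrow> ('o, 'm) category \<Rightarrow> ('i \<Rightarrow> 'o) \<Rightarrow> ('k \<Rightarrow> 'm) \<Rightarrow> bool" where
  "is_functor J C Fo Fa \<longleftrightarrow>
     (\<forall>j\<in>Obj J. Fo j \<in> Obj C) \<and>
     (\<forall>u\<in>Arr J. Fa u \<in> hom C (Fo (Dom J u)) (Fo (Cod J u))) \<and>
     (\<forall>j\<in>Obj J. Fa (Id J j) = Id C (Fo j)) \<and>
     (\<forall>u\<in>Arr J. \<forall>v\<in>Arr J. Dom J v = Cod J u \<longrightarrow>
        Fa (Comp J v u) = Comp C (Fa v) (Fa u))"

definition is_cocone ::
  "('o, 'm) category \<Rightarrow> ('i, 'k) category \<Rightarrow> ('i \<Rightarrow> 'o) \<Rightarrow> ('k \<Rightarrow> 'm) \<Rightarrow>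
   'o \<Rightarrow> ('i \<Rightarrow> 'm) \<Rightarrow> bool" where
  "is_cocone C J Fo Fa c \<iota> \<longleftrightarrow>
     c \<in> Obj C \<and>
     (\<forall>j\<in>Obj J. \<iota> j \<in> hom C (Fo j) c) \<and>
     (\<forall>u\<in>Arr J. Comp C (\<iota> (Cod J u)) (Fa u) = \<iota> (Dom J u))"

definition is_colimit ::
  "('o, 'm) category \<Rightarrow> ('i, 'k) category \<Rightarrow> ('i \<Rightarrow> 'o) \<Rightarrow> ('k \<Rightarrow> 'm) \<Rightarrow>
   'o \<Rightarrow> ('i \<Rightarrow> 'm) \<Rightarrow> bool" where
  "is_colimit C J Fo Fa c \<iota> \<longleftrightarrow>
     is_cocone C J Fo Fa c \<iota> \<and>
     (\<forall>c' \<kappa>. is_cocone C J Fo Fa c' \<kappa> \<longrightarrow>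
        (\<exists>!h. h \<in> hom C c c' \<and> (\<forall>j\<in>Obj J. Comp C h (\<iota> j) = \<kappa> j)))"

text \<open>
  Size is measured against an infinite type \<open>'u\<close>, in the role of a Grothendieck universe: a set
  (of elements of any type) is small if it has strictly fewer elements than \<open>'u\<close>. For \<open>'u\<close> of
  inaccessible cardinality this is the usual notion. No closure property of the
  cardinality of \<open>'u\<close> is needed below; any given HOL set \<open>X :: 'a set\<close> becomes small, up to
  bijection, for \<open>'u = ('a + nat) set\<close>.
\<close>

definition small :: "'u itself \<Rightarrow> 'x set \<Rightarrow> bool" where
  "small U S \<longleftrightarrow> S \<prec> (UNIV :: 'u set)"

definition small_category :: "'u itself \<Rightarrow> ('o, 'm) category \<Rightarrow> bool" where
  "small_category U C \<longleftrightarrow> is_category C \<and> small U (Obj C) \<and> small U (Arr C)"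

text \<open>
  The full subcategory is given by its set of objects \<open>G\<close>. Every small category is
  isomorphic to one whose objects and arrows are elements of \<open>'u\<close>, so it is no restriction to
  take the diagram schemes \<open>J\<close> from that type.
\<close>

definition colimit_dense :: "'u itself \<Rightarrow> ('o, 'm) category \<Rightarrow> 'o set \<Rightarrow> bool" where
  "colimit_dense U C G \<longleftrightarrow>
     G \<subseteq> Obj C \<and> small_category U (full_subcat C G) \<and>
     (\<forall>X\<in>Obj C. \<exists>(J :: ('u, 'u) category) Fo Fa \<iota>.
        small_category U J \<and>
        is_functor J (full_subcat C G) Fo Fa \<and>
        is_colimit C J Fo Fa X \<iota>)"

text \<open>
  The category of small sets and functions. Up to isomorphism every small set is a subset of
  \<open>'u\<close>. An arrow \<open>(A, f, B)\<close> carries its domain and codomain, and \<open>f\<close> is \<open>undefined\<close> outside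
  \<open>A\<close>, so that arrows are equal iff they are equal as functions from \<open>A\<close> to \<open>B\<close>.
\<close>

definition Set_cat :: "('u set, 'u set \<times> ('u \<Rightarrow> 'u) \<times> 'u set) category" where
  "Set_cat = \<lparr>
     Obj = {A. small TYPE('u) A},
     Arr = {(A, f, B). small TYPE('u) A \<and> small TYPE('u) B \<and> f \<in> A \<rightarrow>\<^sub>E B},
     Dom = (\<lambda>(A, f, B). A),
     Cod = (\<lambda>(A, f, B). B),
     Id = (\<lambda>A. (A, \<lambda>x\<in>A. x, A)),
     Comp = (\<lambda>(B', g, C) (A, f, B). (A, compose A g f, C))\<rparr>"

lemma is_category_op_cat: "is_category C \<Longrightarrow> is_category (op_cat C)"
  unfolding is_category_def op_cat_def hom_def by simp

lemma is_category_Set_cat: "is_category Set_cat"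
proof -
  have 1: "compose A g f x \<in> D" if "f \<in> A \<rightarrow>\<^sub>E B" "g \<in> B \<rightarrow>\<^sub>E D" "x \<in> A"
    for A B D :: "'a set" and f g x
    using that by (auto simp: compose_def)
  have 4: "compose A g f x = undefined" if "x \<notin> A"
    for A :: "'a set" and f g :: "'a \<Rightarrow> 'a" and x
    using that by (simp add: compose_def)
  have 2: "compose A f (\<lambda>x\<in>A. x) = f" "compose A (\<lambda>x\<in>B. x) f = f" if "f \<in> A \<rightarrow>\<^sub>E B"
    for A B :: "'a set" and f
    using that by (auto simp: compose_def fun_eq_iff PiE_def extensional_def)
  have 3: "compose A h (compose A g f) = compose A (compose B h g) f"
    if "f \<in> A \<rightarrow>\<^sub>E B" for A B :: "'a set" and f g h
    using that by (auto simp: compose_def fun_eq_iff)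
  show ?thesis
    unfolding is_category_def Set_cat_def hom_def
    using 2 3 by (auto simp: case_prod_beta intro: 1 4)
qed

text \<open>
  A colimit in the opposite of \<open>Set_cat\<close> is a limit of sets in the unrestricted sense: the
  universal property also holds for families of maps out of a set \<open>W\<close> of any type
  and any size.
\<close>

lemma colimit_op_Set_cat_universal:
  fixes X :: "'u set" and W :: "'w set" and \<phi> :: "'i \<Rightarrow> 'w \<Rightarrow> 'u"
  assumes inf: "infinite (UNIV :: 'u set)"
    and J: "is_category J"
    and fn: "is_functor J (op_cat Set_cat) Fo Fa"
    and col: "is_colimit (op_cat Set_cat) J Fo Fa X \<iota>"
    and \<phi>: "\<And>j. j \<in> Obj J \<Longrightarrow> \<phi> j \<in> W \<rightarrow> Fo j"
    and nat: "\<And>u w. u \<in> Arr J \<Longrightarrow> w \<in> W \<Longrightarrow>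
               fst (snd (Fa u)) (\<phi> (Cod J u) w) = \<phi> (Dom J u) w"
  shows "\<exists>!h. h \<in> W \<rightarrow>\<^sub>E X \<and> (\<forall>j\<in>Obj J. \<forall>w\<in>W. fst (snd (\<iota> j)) (h w) = \<phi> j w)"
proof -
  define p where "p = (undefined :: 'u)"
  have smp: "small TYPE('u) {p}"
    unfolding small_def using inf by (simp add: finite_lesspoll_infinite)
  have X: "small TYPE('u) X"
    using col by (simp add: is_colimit_def is_cocone_def op_cat_def Set_cat_def)
  have Fo: "small TYPE('u) (Fo j)" if "j \<in> Obj J" for j
    using fn that by (simp add: is_functor_def op_cat_def Set_cat_def)
  have io: "\<exists>f. \<iota> j = (X, f, Fo j) \<and> f \<in> X \<rightarrow>\<^sub>E Fo j" if "j \<in> Obj J" for j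
    using col that
    by (fastforce simp: is_colimit_def is_cocone_def op_cat_def Set_cat_def hom_def)
  have Fa: "\<exists>f. Fa u = (Fo (Cod J u), f, Fo (Dom J u))" if "u \<in> Arr J" for u
    using fn that by (fastforce simp: is_functor_def op_cat_def Set_cat_def hom_def)
  have JO: "Dom J u \<in> Obj J" "Cod J u \<in> Obj J" if "u \<in> Arr J" for u
    using J that by (auto simp: is_category_def)
  have pt: "\<exists>!x. x \<in> X \<and> (\<forall>j\<in>Obj J. fst (snd (\<iota> j)) x = \<phi> j w)" if w: "w \<in> W" for w
  proof -
    define \<kappa> where "\<kappa> = (\<lambda>j. ({p}, \<lambda>x\<in>{p}. \<phi> j w, Fo j))"
    have "is_cocone (op_cat Set_cat) J Fo Fa {p} \<kappa>"
      unfolding is_cocone_def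
    proof (intro conjI ballI)
      show "{p} \<in> Obj (op_cat Set_cat)" using smp by (simp add: op_cat_def Set_cat_def)
      show "\<kappa> j \<in> hom (op_cat Set_cat) (Fo j) {p}" if "j \<in> Obj J" for j
        using that smp Fo \<phi>[OF that] w by (auto simp: \<kappa>_def op_cat_def Set_cat_def hom_def)
      show "Comp (op_cat Set_cat) (\<kappa> (Cod J u)) (Fa u) = \<kappa> (Dom J u)" if "u \<in> Arr J" for u
        using Fa[OF that] nat[OF that w]
        by (auto simp: \<kappa>_def op_cat_def Set_cat_def compose_def fun_eq_iff)
    qed
    then have ex1: "\<exists>!h. h \<in> hom (op_cat Set_cat) X {p} \<and>
        (\<forall>j\<in>Obj J. Comp (op_cat Set_cat) h (\<iota> j) = \<kappa> j)"
      using col by (simp add: is_colimit_def)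
    have key: "({p}, \<lambda>y\<in>{p}. x, X) \<in> hom (op_cat Set_cat) X {p} \<and>
        (\<forall>j\<in>Obj J. Comp (op_cat Set_cat) ({p}, \<lambda>y\<in>{p}. x, X) (\<iota> j) = \<kappa> j)
        \<longleftrightarrow> x \<in> X \<and> (\<forall>j\<in>Obj J. fst (snd (\<iota> j)) x = \<phi> j w)" for x
    proof -
      have "Comp (op_cat Set_cat) ({p}, \<lambda>y\<in>{p}. x, X) (\<iota> j) = \<kappa> j
          \<longleftrightarrow> fst (snd (\<iota> j)) x = \<phi> j w" if "j \<in> Obj J" for j
        using io[OF that]
        by (auto simp: \<kappa>_def op_cat_def Set_cat_def compose_def fun_eq_iff
            dest!: spec[of _ p])
      moreover have "({p}, \<lambda>y\<in>{p}. x, X) \<in> hom (op_cat Set_cat) X {p} \<longleftrightarrow> x \<in> X"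
        using smp X by (auto simp: op_cat_def Set_cat_def hom_def)
      ultimately show ?thesis by auto
    qed
    from ex1 obtain h where h: "h \<in> hom (op_cat Set_cat) X {p}"
        "\<forall>j\<in>Obj J. Comp (op_cat Set_cat) h (\<iota> j) = \<kappa> j" by blast
    then obtain f where f: "h = ({p}, f, X)" "f \<in> {p} \<rightarrow>\<^sub>E X"
      by (fastforce simp: op_cat_def Set_cat_def hom_def)
    have "f = (\<lambda>y\<in>{p}. f p)"
      using f(2) by (auto simp: fun_eq_iff PiE_def extensional_def)
    then have "h = ({p}, \<lambda>y\<in>{p}. f p, X)" using f(1) by simp
    with h key have fp: "f p \<in> X \<and> (\<forall>j\<in>Obj J. fst (snd (\<iota> j)) (f p) = \<phi> j w)" by metis
    show ?thesis
    proof (rule ex1I[of _ "f p"])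
      show "f p \<in> X \<and> (\<forall>j\<in>Obj J. fst (snd (\<iota> j)) (f p) = \<phi> j w)" by (rule fp)
      fix x assume "x \<in> X \<and> (\<forall>j\<in>Obj J. fst (snd (\<iota> j)) x = \<phi> j w)"
      with key fp ex1 have "({p}, \<lambda>y\<in>{p}. x, X) = ({p}, \<lambda>y\<in>{p}. f p, X)" by metis
      then have "(\<lambda>y\<in>{p}. x) p = (\<lambda>y\<in>{p}. f p) p" by (metis prod.inject)
      then show "x = f p" by simp
    qed
  qed
  define h where "h = (\<lambda>w\<in>W. THE x. x \<in> X \<and> (\<forall>j\<in>Obj J. fst (snd (\<iota> j)) x = \<phi> j w))"
  have h: "h w \<in> X \<and> (\<forall>j\<in>Obj J. fst (snd (\<iota> j)) (h w) = \<phi> j w)" if "w \<in> W" for w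
    using theI'[OF pt[OF that]] that by (simp add: h_def)
  show ?thesis
  proof (rule ex1I[of _ h])
    show "h \<in> W \<rightarrow>\<^sub>E X \<and> (\<forall>j\<in>Obj J. \<forall>w\<in>W. fst (snd (\<iota> j)) (h w) = \<phi> j w)"
      using h by (auto simp: h_def)
    fix k assume k: "k \<in> W \<rightarrow>\<^sub>E X \<and> (\<forall>j\<in>Obj J. \<forall>w\<in>W. fst (snd (\<iota> j)) (k w) = \<phi> j w)"
    show "k = h"
    proof
      fix w show "k w = h w"
      proof (cases "w \<in> W")
        case True
        then have "k w \<in> X \<and> (\<forall>j\<in>Obj J. fst (snd (\<iota> j)) (k w) = \<phi> j w)" using k by auto
        with h[OF True] pt[OF True] show ?thesis by blast
      next
        case False
        with k have "k w = undefined" by (auto simp: PiE_def extensional_def)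
        with False show ?thesis by (simp add: h_def)
      qed
    qed
  qed
qed

end

theory Submission
  imports Defs
begin

text \<open>
  Colimits in the opposite category are limits of sets, so the claim is that every small set \<open>X\<close>
  is the limit of a small diagram all of whose vertices are \<open>T\<close>.

  A system of equations \<open>f (q v) = g (q w)\<close> between \<open>T\<close>-valued variables, with \<open>f\<close> and \<open>g\<close> maps
  \<open>T \<rightarrow> T\<close>, is such a diagram: it has one vertex for each variable and one for each equation, and
  its limit is the set of solutions (\<open>solution_set_is_colimit\<close>). It remains to exhibit \<open>X\<close> as the
  solution set of a small system. The equations \<open>z = q\<close> and \<open>u = q\<close>, for constants \<open>z \<noteq> u\<close>, have no
  solution, so they settle the empty set.

  If \<open>X\<close> is not empty, choose \<open>p \<in> X\<close> and let \<open>I = X - {p}\<close>. Points of \<open>X\<close> correspond to functions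
  \<open>I \<rightarrow> {z, u}\<close> that take the value \<open>u\<close> at most once: \<open>x \<in> I\<close> is the indicator of \<open>{x}\<close>, and \<open>p\<close> is
  constantly \<open>z\<close>. (For infinite \<open>I\<close> this is the one-point compactification of the discrete set \<open>I\<close>,
  as a closed subset of \<open>{z, u}\<^sup>I\<close>.) Such a function is specified by conditions on pairs of
  distinct coordinates: each pair takes one of the three values \<open>(z, z)\<close>, \<open>(u, z)\<close>, \<open>(z, u)\<close>, which
  is where the three elements of \<open>T\<close> come from. So the system has a variable for every pair
  \<open>(i, j)\<close>. If \<open>i \<noteq> j\<close>, its value in \<open>T = {z, u, t}\<close> encodes the pair of coordinates, and the
  equations identify the two decoded components with the diagonal variables \<open>(i, i)\<close> and \<open>(j, j)\<close>;
  one more equation confines each diagonal variable to \<open>{z, u}\<close> (\<open>solutions_of_pair_system\<close>).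
  The vertices and arrows are indexed by finitely many copies of \<open>I \<times> I\<close>, so the diagram is small
  for every infinite universe; the canonical diagram of all maps \<open>X \<rightarrow> T\<close> need not be.
\<close>

section \<open>Smallness\<close>

lemma small_finite:
  assumes "infinite (UNIV :: 'u set)" "finite S"
  shows "small TYPE('u) S"
  using assms by (simp add: small_def finite_lesspoll_infinite)

lemma small_lepoll: "small U B \<Longrightarrow> A \<lesssim> B \<Longrightarrow> small U A"
  unfolding small_def by (rule lesspoll_trans1)

lemma small_imp_inj:
  fixes S :: "'x set"
  assumes "small TYPE('u) S"
  obtains e :: "'x \<Rightarrow> 'u" where "inj_on e S"
  using assms by (auto simp: small_def lesspoll_def lepoll_def)

lemma small_Times:
  includes cardinal_syntax
  assumes inf: "infinite (UNIV :: 'u set)"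
    and A: "small TYPE('u) A" and B: "small TYPE('u) B"
  shows "small TYPE('u) (A \<times> B)"
proof (cases "finite A \<and> finite B")
  case True
  then show ?thesis by (simp add: small_finite inf)
next
  case False
  show ?thesis
  proof (cases "A = {} \<or> B = {}")
    case True
    then show ?thesis by (intro small_finite[OF inf]) auto
  next
    case ne: False
    consider "|A| \<le>o |B|" | "|B| \<le>o |A|"
      using ordLeq_total[OF card_of_Well_order card_of_Well_order] by auto
    then show ?thesis
    proof cases
      case 1
      then have "infinite B" using False card_of_ordLeq_finite by blast
      then have "|A \<times> B| \<le>o |B|"
        using card_of_Times_infinite_simps(3)[of B A] 1 ne by (auto intro: ordIso_imp_ordLeq)
      then have "A \<times> B \<lesssim> B" unfolding lepoll_def card_of_ordLeq .
      with B show ?thesis by (rule small_lepoll)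
    next
      case 2
      then have "infinite A" using False card_of_ordLeq_finite by blast
      then have "|A \<times> B| \<le>o |A|"
        using card_of_Times_infinite_simps(1)[of A B] 2 ne by (auto intro: ordIso_imp_ordLeq)
      then have "A \<times> B \<lesssim> A" unfolding lepoll_def card_of_ordLeq .
      with A show ?thesis by (rule small_lepoll)
    qed
  qed
qed

lemma small_Plus:
  assumes inf: "infinite (UNIV :: 'u set)"
    and A: "small TYPE('u) A" and B: "small TYPE('u) B"
  shows "small TYPE('u) (A <+> B)"
proof -
  \<comment> \<open>The disjoint union embeds in the product of the two sets, each enlarged by one point.\<close>
  have ins: "small TYPE('u) (insert None (Some ` S))" if S: "small TYPE('u) S" for S :: "'s set"
  proof (cases "finite S")
    case True
    then show ?thesis by (simp add: small_finite inf)
  next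
    case False
    have "insert None (Some ` S) \<lesssim> Some ` S"
      using False by (intro eqpoll_imp_lepoll infinite_insert_eqpoll) (simp add: finite_image_iff)
    then have "insert None (Some ` S) \<lesssim> S" using image_lepoll by (rule lepoll_trans)
    then show ?thesis using S small_lepoll by blast
  qed
  let ?P = "insert None (Some ` A) \<times> insert None (Some ` B)"
  have "inj_on (case_sum (\<lambda>a. (Some a, None)) (\<lambda>b. (None, Some b))) (A <+> B)"
    by (auto simp: inj_on_def)
  then have "A <+> B \<lesssim> ?P"
    unfolding lepoll_def
    by (intro exI[of _ "case_sum (\<lambda>a. (Some a, None)) (\<lambda>b. (None, Some b))"]) auto
  then show ?thesis using small_Times[OF inf ins[OF A] ins[OF B]] small_lepoll by blast
qed


section \<open>Full subcategories and diagram schemes\<close>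

lemma is_category_full_subcat:
  assumes "is_category C" "G \<subseteq> Obj C"
  shows "is_category (full_subcat C G)"
  using assms unfolding is_category_def full_subcat_def hom_def by (auto simp: subset_iff)

text \<open>A small colimit diagram indexed by a category on arbitrary types can be reindexed by an
  isomorphic category whose objects and arrows are taken from the universe.\<close>

lemma reindex_small_colimit:
  fixes J :: "('i, 'k) category"
  assumes J: "is_category J" and sO: "small TYPE('u) (Obj J)" and sA: "small TYPE('u) (Arr J)"
    and fn: "is_functor J D Fo Fa" and col: "is_colimit C J Fo Fa c \<iota>"
  shows "\<exists>(J' :: ('u, 'u) category) Fo' Fa' \<iota>'.
    small_category TYPE('u) J' \<and> is_functor J' D Fo' Fa' \<and> is_colimit C J' Fo' Fa' c \<iota>'"
proof -
  obtain eo :: "'i \<Rightarrow> 'u" where eo: "inj_on eo (Obj J)" using sO by (rule small_imp_inj)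
  obtain ea :: "'k \<Rightarrow> 'u" where ea: "inj_on ea (Arr J)" using sA by (rule small_imp_inj)
  define ro where "ro = inv_into (Obj J) eo"
  define ra where "ra = inv_into (Arr J) ea"
  have ro[simp]: "ro (eo j) = j" if "j \<in> Obj J" for j
    using eo that by (simp add: ro_def)
  have ra[simp]: "ra (ea u) = u" if "u \<in> Arr J" for u
    using ea that by (simp add: ra_def)
  define J' where "J' = \<lparr>Obj = eo ` Obj J, Arr = ea ` Arr J,
    Dom = (\<lambda>u. eo (Dom J (ra u))), Cod = (\<lambda>u. eo (Cod J (ra u))),
    Id = (\<lambda>j. ea (Id J (ro j))), Comp = (\<lambda>v u. ea (Comp J (ra v) (ra u)))\<rparr>"
  have JO: "Dom J u \<in> Obj J" "Cod J u \<in> Obj J" if "u \<in> Arr J" for u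
    using J that by (auto simp: is_category_def)
  have eo_eq: "eo i = eo j \<longleftrightarrow> i = j" if "i \<in> Obj J" "j \<in> Obj J" for i j
    using eo that by (auto simp: inj_on_def)
  have Id: "Id J j \<in> Arr J" "Dom J (Id J j) = j" "Cod J (Id J j) = j" if "j \<in> Obj J" for j
    using J that by (auto simp: is_category_def hom_def)
  have Comp: "Comp J v u \<in> Arr J" "Dom J (Comp J v u) = Dom J u" "Cod J (Comp J v u) = Cod J v"
    if "u \<in> Arr J" "v \<in> Arr J" "Dom J v = Cod J u" for u v
    using J that by (auto simp: is_category_def hom_def)
  have cat: "is_category J'"
    using J unfolding is_category_def[of J]
    by (simp add: is_category_def J'_def hom_def JO Id Comp eo_eq)
  have "small_category TYPE('u) J'"
    using cat small_lepoll[OF sO image_lepoll[of eo]] small_lepoll[OF sA image_lepoll[of ea]]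
    by (simp add: small_category_def J'_def)
  moreover have "is_functor J' D (Fo \<circ> ro) (Fa \<circ> ra)"
    using fn by (auto simp: is_functor_def J'_def JO Id Comp eo_eq)
  moreover have cc: "is_cocone C J' (Fo \<circ> ro) (Fa \<circ> ra) d \<kappa> \<longleftrightarrow> is_cocone C J Fo Fa d (\<kappa> \<circ> eo)"
    for d \<kappa>
    by (simp add: is_cocone_def J'_def JO)
  have "is_colimit C J' (Fo \<circ> ro) (Fa \<circ> ra) c (\<iota> \<circ> ro)"
    unfolding is_colimit_def cc
  proof (intro conjI allI impI)
    show "is_cocone C J Fo Fa c (\<iota> \<circ> ro \<circ> eo)"
      using col by (simp add: is_colimit_def is_cocone_def JO)
    fix d \<kappa> assume "is_cocone C J Fo Fa d (\<kappa> \<circ> eo)"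
    then have "\<exists>!h. h \<in> hom C c d \<and> (\<forall>j\<in>Obj J. Comp C h (\<iota> j) = (\<kappa> \<circ> eo) j)"
      using col unfolding is_colimit_def by blast
    then show "\<exists>!h. h \<in> hom C c d \<and> (\<forall>j\<in>Obj J'. Comp C h ((\<iota> \<circ> ro) j) = \<kappa> j)"
      by (simp add: J'_def)
  qed
  ultimately show ?thesis by blast
qed


section \<open>Solution sets of equations as limits\<close>

lemma hom_op_Set_cat:
  "h \<in> hom (op_cat Set_cat) A B \<longleftrightarrow>
    (\<exists>f. h = (B, f, A) \<and> small TYPE('u) A \<and> small TYPE('u) B \<and> f \<in> B \<rightarrow>\<^sub>E A)"
  for A B :: "'u set"
  by (auto simp: hom_def op_cat_def Set_cat_def)

lemma Comp_op_Set_cat: "Comp (op_cat Set_cat) (A, f, B) (B', g, C) = (A, compose A g f, C)"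
  by (simp add: op_cat_def Set_cat_def)

lemma Obj_op_Set_cat: "Obj (op_cat Set_cat) = {A :: 'u set. small TYPE('u) A}"
  by (simp add: op_cat_def Set_cat_def)

text \<open>
  The scheme of a system of equations with variables \<open>V\<close> and equations \<open>C\<close>, where \<open>s c True\<close> and
  \<open>s c False\<close> are the variables on the two sides of \<open>c\<close>. It is the free category on the graph with
  vertices \<open>V <+> C\<close> and, for every \<open>c\<close>, two edges from \<open>c\<close> to the variables of \<open>c\<close>; this is the
  direction needed for diagrams in an opposite category. The arrow \<open>Inl j\<close> is the
  identity of \<open>j\<close>, and \<open>Inr (c, b)\<close> is the edge from \<open>c\<close> to \<open>s c b\<close>. Two edges are never
  composable, so one of two composable arrows is an identity.
\<close>

definition equation_scheme ::
  "'v set \<Rightarrow> 'c set \<Rightarrow> ('c \<Rightarrow> bool \<Rightarrow> 'v) \<Rightarrow> ('v + 'c, ('v + 'c) + ('c \<times> bool)) category" where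
  "equation_scheme V C s = \<lparr>
     Obj = V <+> C,
     Arr = (V <+> C) <+> (C \<times> UNIV),
     Dom = case_sum (\<lambda>j. j) (\<lambda>(c, b). Inr c),
     Cod = case_sum (\<lambda>j. j) (\<lambda>(c, b). Inl (s c b)),
     Id = Inl,
     Comp = (\<lambda>v u. case u of Inl _ \<Rightarrow> v | Inr _ \<Rightarrow> u)\<rparr>"

lemma is_category_equation_scheme:
  assumes "\<And>c b. c \<in> C \<Longrightarrow> s c b \<in> V"
  shows "is_category (equation_scheme V C s)"
  unfolding is_category_def equation_scheme_def hom_def using assms
  by (auto split: sum.splits)

text \<open>
  The equation \<open>c\<close> is \<open>f c True (q (s c True)) = f c False (q (s c False))\<close>. If the maps
  \<open>\<pi> v : X \<rightarrow> T\<close> identify \<open>X\<close> with the set of solutions \<open>q : V \<rightarrow> T\<close>, then \<open>X\<close> is a limit of copies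
  of \<open>T\<close>.
\<close>

lemma solution_set_is_colimit:
  fixes T X :: "'u set" and V :: "'v set" and C :: "'c set"
  assumes inf: "infinite (UNIV :: 'u set)"
    and T: "small TYPE('u) T" and X: "small TYPE('u) X"
    and V: "small TYPE('u) V" and C: "small TYPE('u) C"
    and s: "\<And>c b. c \<in> C \<Longrightarrow> s c b \<in> V"
    and f: "\<And>c b. c \<in> C \<Longrightarrow> f c b \<in> T \<rightarrow> T"
    and \<pi>: "\<And>v. v \<in> V \<Longrightarrow> \<pi> v \<in> X \<rightarrow> T"
    and sol: "\<And>c x. c \<in> C \<Longrightarrow> x \<in> X \<Longrightarrow>
      f c True (\<pi> (s c True) x) = f c False (\<pi> (s c False) x)"
    and univ: "\<And>q. q \<in> V \<rightarrow> T \<Longrightarrow>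
      (\<And>c. c \<in> C \<Longrightarrow> f c True (q (s c True)) = f c False (q (s c False))) \<Longrightarrow>
      \<exists>!x. x \<in> X \<and> (\<forall>v\<in>V. \<pi> v x = q v)"
  shows "\<exists>(J :: ('u, 'u) category) Fo Fa \<iota>. small_category TYPE('u) J \<and>
    is_functor J (full_subcat (op_cat Set_cat) {T}) Fo Fa \<and>
    is_colimit (op_cat Set_cat) J Fo Fa X \<iota>"
proof -
  let ?J = "equation_scheme V C s"
  let ?S = "op_cat Set_cat :: ('u set, 'u set \<times> ('u \<Rightarrow> 'u) \<times> 'u set) category"
  define Fo where "Fo = (\<lambda>j :: 'v + 'c. T)"
  define Fa where "Fa = case_sum (\<lambda>j :: 'v + 'c. (T, \<lambda>y\<in>T. y, T))
    (\<lambda>(c, b). (T, restrict (f c b) T, T))"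
  define \<iota> where "\<iota> = case_sum (\<lambda>v. (X, restrict (\<pi> v) X, T))
    (\<lambda>c. (X, \<lambda>x\<in>X. f c True (\<pi> (s c True) x), T))"
  have fn: "is_functor ?J (full_subcat ?S {T}) Fo Fa"
    unfolding is_functor_def
  proof (intro conjI ballI impI)
    show "Fo j \<in> Obj (full_subcat ?S {T})" for j by (simp add: Fo_def full_subcat_def)
    show "Fa (Id ?J j) = Id (full_subcat ?S {T}) (Fo j)" for j
      by (simp add: Fo_def Fa_def full_subcat_def equation_scheme_def op_cat_def Set_cat_def)
    show "Fa u \<in> hom (full_subcat ?S {T}) (Fo (Dom ?J u)) (Fo (Cod ?J u))" if "u \<in> Arr ?J" for u
      using that T funcset_mem[OF f]
      by (auto simp: Fo_def Fa_def full_subcat_def equation_scheme_def hom_def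
          op_cat_def Set_cat_def)
    show "Fa (Comp ?J v u) = Comp (full_subcat ?S {T}) (Fa v) (Fa u)"
      if "u \<in> Arr ?J" "v \<in> Arr ?J" "Dom ?J v = Cod ?J u" for u v
      using that f
      by (auto simp: Fa_def full_subcat_def equation_scheme_def Comp_op_Set_cat compose_def
          fun_eq_iff Pi_iff split: if_splits)
  qed
  have col: "is_colimit ?S ?J Fo Fa X \<iota>"
    unfolding is_colimit_def
  proof (intro conjI allI impI)
    show "is_cocone ?S ?J Fo Fa X \<iota>"
      unfolding is_cocone_def
    proof (intro conjI ballI)
      show "X \<in> Obj ?S" using X by (simp add: Obj_op_Set_cat)
      show "\<iota> j \<in> hom ?S (Fo j) X" if "j \<in> Obj ?J" for j
        using that X T \<pi> f s
        by (fastforce simp: \<iota>_def Fo_def hom_op_Set_cat equation_scheme_def Pi_iff)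
      show "Comp ?S (\<iota> (Cod ?J u)) (Fa u) = \<iota> (Dom ?J u)" if "u \<in> Arr ?J" for u
      proof (cases u)
        case (Inl j)
        then show ?thesis using that \<pi> f s
          by (cases j) (auto simp: \<iota>_def Fa_def equation_scheme_def Comp_op_Set_cat compose_def
              fun_eq_iff Pi_iff)
      next
        case (Inr cb)
        obtain c b where cb: "cb = (c, b)" by fastforce
        with that Inr have "c \<in> C" by (auto simp: equation_scheme_def)
        then show ?thesis using Inr cb sol[of c] \<pi> s
          by (cases b) (auto simp: \<iota>_def Fa_def equation_scheme_def Comp_op_Set_cat compose_def
              fun_eq_iff Pi_iff)
      qed
    qed
  next
    fix W \<kappa> assume co: "is_cocone ?S ?J Fo Fa W \<kappa>"
    have W: "small TYPE('u) W" using co by (simp add: is_cocone_def Obj_op_Set_cat)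
    define k where "k = (\<lambda>j. fst (snd (\<kappa> j)))"
    have \<kappa>: "\<kappa> j = (W, k j, T) \<and> k j \<in> W \<rightarrow>\<^sub>E T" if "j \<in> V <+> C" for j
    proof -
      have "\<kappa> j \<in> hom ?S T W"
        using co that by (simp add: is_cocone_def Fo_def equation_scheme_def)
      then show ?thesis by (auto simp: hom_op_Set_cat k_def)
    qed
    have k_eqn: "f c b (k (Inl (s c b)) w) = k (Inr c) w" if c: "c \<in> C" and w: "w \<in> W" for c b w
    proof -
      have "Comp ?S (\<kappa> (Inl (s c b))) (Fa (Inr (c, b))) = \<kappa> (Inr c)"
        using co c by (force simp: is_cocone_def equation_scheme_def)
      then have "compose W (restrict (f c b) T) (k (Inl (s c b))) = k (Inr c)"
        using \<kappa>[OF InlI[OF s[OF c]]] \<kappa>[OF InrI[OF c]]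
        by (simp add: Fa_def Comp_op_Set_cat)
      then have "compose W (restrict (f c b) T) (k (Inl (s c b))) w = k (Inr c) w" by simp
      moreover have "k (Inl (s c b)) w \<in> T" using \<kappa>[of "Inl (s c b)"] s[OF c] w by auto
      ultimately show ?thesis using w by (simp add: compose_def)
    qed
    have pt: "\<exists>!x. x \<in> X \<and> (\<forall>v\<in>V. \<pi> v x = k (Inl v) w)" if w: "w \<in> W" for w
    proof (rule univ)
      show "(\<lambda>v. k (Inl v) w) \<in> V \<rightarrow> T" using \<kappa> w by blast
      show "f c True (k (Inl (s c True)) w) = f c False (k (Inl (s c False)) w)" if "c \<in> C" for c
        using k_eqn that w by simp
    qed
    have mediating: "(h \<in> hom ?S X W \<and> (\<forall>j\<in>Obj ?J. Comp ?S h (\<iota> j) = \<kappa> j)) \<longleftrightarrow>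
      (\<exists>g. h = (W, g, X) \<and> g \<in> W \<rightarrow>\<^sub>E X \<and> (\<forall>w\<in>W. \<forall>v\<in>V. \<pi> v (g w) = k (Inl v) w))" for h
    proof -
      have var: "Comp ?S (W, g, X) (\<iota> (Inl v)) = \<kappa> (Inl v) \<longleftrightarrow>
          (\<forall>w\<in>W. \<pi> v (g w) = k (Inl v) w)"
        if g: "g \<in> W \<rightarrow>\<^sub>E X" and v: "v \<in> V" for g v
      proof -
        have "k (Inl v) \<in> extensional W" using \<kappa>[OF InlI[OF v]] by (auto simp: PiE_def)
        then show ?thesis using \<kappa>[OF InlI[OF v]] PiE_mem[OF g]
          by (auto simp: \<iota>_def Comp_op_Set_cat compose_def fun_eq_iff extensional_def)
      qed
      have eqn: "Comp ?S (W, g, X) (\<iota> (Inr c)) = \<kappa> (Inr c)"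
        if g: "g \<in> W \<rightarrow>\<^sub>E X" and v: "\<forall>w\<in>W. \<forall>v\<in>V. \<pi> v (g w) = k (Inl v) w" and c: "c \<in> C" for g c
      proof -
        have "k (Inr c) \<in> extensional W" using \<kappa>[OF InrI[OF c]] by (auto simp: PiE_def)
        then show ?thesis using \<kappa>[OF InrI[OF c]] PiE_mem[OF g] v s[OF c] k_eqn[OF c]
          by (auto simp: \<iota>_def Comp_op_Set_cat compose_def fun_eq_iff extensional_def)
      qed
      have "(\<forall>j\<in>V <+> C. Comp ?S (W, g, X) (\<iota> j) = \<kappa> j) \<longleftrightarrow>
          (\<forall>w\<in>W. \<forall>v\<in>V. \<pi> v (g w) = k (Inl v) w)" if "g \<in> W \<rightarrow>\<^sub>E X" for g
        using var[OF that] eqn[OF that] by blast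
      then show ?thesis using X W by (auto simp: hom_op_Set_cat equation_scheme_def)
    qed
    define g where "g = (\<lambda>w\<in>W. THE x. x \<in> X \<and> (\<forall>v\<in>V. \<pi> v x = k (Inl v) w))"
    have g: "g w \<in> X \<and> (\<forall>v\<in>V. \<pi> v (g w) = k (Inl v) w)" if "w \<in> W" for w
      using theI'[OF pt[OF that]] that by (simp add: g_def)
    have gE: "g \<in> W \<rightarrow>\<^sub>E X" using g by (auto simp: g_def)
    have uniq: "g' = g" if "g' \<in> W \<rightarrow>\<^sub>E X" "\<forall>w\<in>W. \<forall>v\<in>V. \<pi> v (g' w) = k (Inl v) w" for g'
    proof (rule PiE_ext[OF that(1) gE])
      show "g' w = g w" if w: "w \<in> W" for w
        using pt[OF w] g[OF w] \<open>\<forall>w\<in>W. \<forall>v\<in>V. \<pi> v (g' w) = k (Inl v) w\<close>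
          PiE_mem[OF \<open>g' \<in> W \<rightarrow>\<^sub>E X\<close> w] w by blast
    qed
    show "\<exists>!h. h \<in> hom ?S X W \<and> (\<forall>j\<in>Obj ?J. Comp ?S h (\<iota> j) = \<kappa> j)"
      unfolding mediating
    proof (rule ex1I[of _ "(W, g, X)"])
      show "\<exists>g'. (W, g, X) = (W, g', X) \<and> g' \<in> W \<rightarrow>\<^sub>E X \<and> (\<forall>w\<in>W. \<forall>v\<in>V. \<pi> v (g' w) = k (Inl v) w)"
        using g gE by (intro exI[of _ g]) simp
    qed (use uniq in blast)
  qed
  have sVC: "small TYPE('u) (V <+> C)" by (rule small_Plus[OF inf V C])
  have "small TYPE('u) (C \<times> (UNIV :: bool set))"
    by (rule small_Times[OF inf C small_finite[OF inf]]) simp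
  then have sArr: "small TYPE('u) ((V <+> C) <+> (C \<times> (UNIV :: bool set)))"
    by (rule small_Plus[OF inf sVC])
  show ?thesis
    by (rule reindex_small_colimit[OF is_category_equation_scheme _ _ fn col])
      (use s sVC sArr in \<open>simp_all add: equation_scheme_def\<close>)
qed


section \<open>A system of equations with a prescribed solution set\<close>

text \<open>
  The value of the variable \<open>(i, j)\<close> at the point \<open>x\<close>: it records whether \<open>x\<close> is \<open>i\<close> (\<open>u\<close>),
  \<open>j\<close> (\<open>t\<close>) or neither (\<open>z\<close>). On the diagonal only \<open>u\<close> and \<open>z\<close> occur.
\<close>

definition pair_code :: "'b \<Rightarrow> 'b \<Rightarrow> 'b \<Rightarrow> 'a \<times> 'a \<Rightarrow> 'a \<Rightarrow> 'b" where
  "pair_code z u t ij x = (if x = fst ij then u else if x = snd ij then t else z)"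

text \<open>
  \<open>decode z u a\<close> sends \<open>a\<close> to \<open>u\<close> and everything else to \<open>z\<close>. The first coordinate of a code is
  \<open>decode z u u\<close>, the second \<open>decode z u t\<close>.
\<close>

definition decode :: "'b \<Rightarrow> 'b \<Rightarrow> 'b \<Rightarrow> 'b \<Rightarrow> 'b" where
  "decode z u a y = (if y = a then u else z)"

text \<open>
  Every solution is given by a unique point of \<open>X\<close>. At most one diagonal variable has the value
  \<open>u\<close>: if \<open>(i, i)\<close> has it, then the variable \<open>(j, i)\<close> has the code \<open>t\<close>, which makes \<open>(j, j)\<close> equal to
  \<open>z\<close>. The solution comes from that \<open>i\<close> if it exists and from the base point \<open>p\<close> otherwise.
\<close>

lemma solutions_of_pair_system:
  assumes p: "p \<in> X" and T: "distinct [z, u, t]"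
    and q: "\<And>i j. i \<in> X - {p} \<Longrightarrow> j \<in> X - {p} \<Longrightarrow> q (i, j) \<in> {z, u, t}"
    and fst_coord: "\<And>i j. i \<in> X - {p} \<Longrightarrow> j \<in> X - {p} \<Longrightarrow> decode z u u (q (i, j)) = q (i, i)"
    and snd_coord: "\<And>i j. i \<in> X - {p} \<Longrightarrow> j \<in> X - {p} \<Longrightarrow> i \<noteq> j \<Longrightarrow>
      decode z u t (q (i, j)) = q (j, j)"
  shows "\<exists>!x. x \<in> X \<and> (\<forall>v \<in> (X - {p}) \<times> (X - {p}). pair_code z u t v x = q v)"
proof (cases "\<exists>i \<in> X - {p}. q (i, i) = u")
  case True
  then obtain i where i: "i \<in> X - {p}" "q (i, i) = u" by blast
  \<comment> \<open>The first equation determines the variables \<open>(i, j)\<close>, the second those of the form \<open>(j, i)\<close>.\<close>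
  have row: "q (i, j) = u" if "j \<in> X - {p}" for j
    using fst_coord[OF i(1) that] i T by (auto simp: decode_def split: if_splits)
  have col: "q (j, i) = t" if "j \<in> X - {p}" "j \<noteq> i" for j
    using snd_coord[OF that(1) i(1) that(2)] i T by (auto simp: decode_def split: if_splits)
  have diag: "q (j, j) = z" if "j \<in> X - {p}" "j \<noteq> i" for j
    using fst_coord[OF that(1) i(1)] col[OF that] T by (auto simp: decode_def)
  have rest: "q (j, k) = z" if "j \<in> X - {p}" "k \<in> X - {p}" "j \<noteq> i" "k \<noteq> i" for j k
  proof (cases "j = k")
    case True
    then show ?thesis using diag that by simp
  next
    case False
    then show ?thesis
      using fst_coord[of j k] snd_coord[of j k] diag[of j] diag[of k] q[of j k] that T
      by (auto simp: decode_def split: if_splits)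
  qed
  show ?thesis
  proof (rule ex1I[of _ i])
    show "i \<in> X \<and> (\<forall>v \<in> (X - {p}) \<times> (X - {p}). pair_code z u t v i = q v)"
      using i row col rest by (auto simp: pair_code_def)
    fix x assume "x \<in> X \<and> (\<forall>v \<in> (X - {p}) \<times> (X - {p}). pair_code z u t v x = q v)"
    then have "pair_code z u t (i, i) x = u" using i by auto
    then show "x = i" using T by (auto simp: pair_code_def split: if_splits)
  qed
next
  case False
  have diag: "q (i, i) = z" if "i \<in> X - {p}" for i
    using fst_coord[OF that that] False that T by (auto simp: decode_def split: if_splits)
  have all: "q (i, j) = z" if "i \<in> X - {p}" "j \<in> X - {p}" for i j
  proof (cases "i = j")
    case True
    then show ?thesis using diag that by simp
  next
    case False
    then show ?thesis
      using fst_coord[of i j] snd_coord[of i j] diag[of i] diag[of j] q[of i j] that T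
      by (auto simp: decode_def split: if_splits)
  qed
  show ?thesis
  proof (rule ex1I[of _ p])
    show "p \<in> X \<and> (\<forall>v \<in> (X - {p}) \<times> (X - {p}). pair_code z u t v p = q v)"
      using p all by (auto simp: pair_code_def)
    fix x assume x: "x \<in> X \<and> (\<forall>v \<in> (X - {p}) \<times> (X - {p}). pair_code z u t v x = q v)"
    show "x = p"
    proof (rule ccontr)
      assume "x \<noteq> p"
      then have "pair_code z u t (x, x) x = z" using x all by auto
      then show False using T by (auto simp: pair_code_def)
    qed
  qed
qed

theorem proposition3p9:
  fixes T :: "'u set"
  assumes "infinite (UNIV :: 'u set)"
    and "card T = 3"
  shows "colimit_dense TYPE('u) (op_cat Set_cat) {T}"
proof -
  note inf = assms(1)
  obtain z u t where T: "T = {z, u, t}" and d: "distinct [z, u, t]"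
    using assms(2) by (auto simp: card_3_iff)
  have sT: "small TYPE('u) T" using T inf by (simp add: small_finite)
  have sub: "{T} \<subseteq> Obj (op_cat Set_cat)" using sT by (simp add: Obj_op_Set_cat)
  have "finite (T \<rightarrow>\<^sub>E T)" using T by (intro finite_PiE) auto
  then have "finite ({T} \<times> (T \<rightarrow>\<^sub>E T) \<times> {T})" by simp
  moreover have "Arr (full_subcat (op_cat Set_cat) {T}) \<subseteq> {T} \<times> (T \<rightarrow>\<^sub>E T) \<times> {T}"
    by (auto simp: full_subcat_def op_cat_def Set_cat_def)
  ultimately have "finite (Arr (full_subcat (op_cat Set_cat) {T}))" using finite_subset by blast
  then have sc: "small_category TYPE('u) (full_subcat (op_cat Set_cat) {T})"
    unfolding small_category_def
    using is_category_full_subcat[OF is_category_op_cat[OF is_category_Set_cat] sub] inf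
    by (simp add: small_finite) (simp add: small_finite full_subcat_def)
  have "\<exists>(J :: ('u, 'u) category) Fo Fa \<iota>. small_category TYPE('u) J \<and>
      is_functor J (full_subcat (op_cat Set_cat) {T}) Fo Fa \<and>
      is_colimit (op_cat Set_cat) J Fo Fa X \<iota>" if "X \<in> Obj (op_cat Set_cat)" for X
  proof (cases "X = {}")
    case True
    \<comment> \<open>One variable \<open>q\<close> and two equations, \<open>z = q\<close> and \<open>u = q\<close>.\<close>
    let ?f = "\<lambda>c b y. if b then (if c then z else u) else y"
    have unsolvable: "\<not> (\<forall>c. ?f c True y = ?f c False y)" for y
      using d by (auto simp: all_bool_eq)
    show ?thesis
    proof (rule solution_set_is_colimit[OF inf sT, where V = "{()}" and C = "UNIV :: bool set"
          and s = "\<lambda>_ _. ()" and f = ?f and \<pi> = "\<lambda>_ _. z"])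
      fix q :: "unit \<Rightarrow> 'u"
      assume "\<And>c. c \<in> UNIV \<Longrightarrow> ?f c True (q ()) = ?f c False (q ())"
      then have "\<forall>c. ?f c True (q ()) = ?f c False (q ())" by simp
      with unsolvable have False by (rule notE)
      then show "\<exists>!x. x \<in> X \<and> (\<forall>v\<in>{()}. z = q v)" ..
    qed (use T True in \<open>auto simp: small_finite inf\<close>)
  next
    case False
    then obtain p where p: "p \<in> X" by blast
    define I where "I = X - {p}"
    have sX: "small TYPE('u) X" using that by (simp add: Obj_op_Set_cat)
    have sI: "small TYPE('u) I"
      using sX by (rule small_lepoll) (auto simp: I_def intro: subset_imp_lepoll)
    have sV: "small TYPE('u) (I \<times> I)" by (rule small_Times[OF inf sI sI])
    have sC: "small TYPE('u) ((I \<times> I) \<times> (UNIV :: bool set))"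
      by (rule small_Times[OF inf sV small_finite[OF inf]]) simp
    \<comment> \<open>The equations are indexed by a pair \<open>(i, j)\<close> and a choice \<open>a\<close> of the first or second
      coordinate. For the second coordinate of a diagonal variable the equation is
      made trivial: \<open>decode z u t\<close> would be constantly \<open>z\<close> on the codes used there.\<close>
    let ?s = "\<lambda>(ij, a) b. if b then ij else if a then (fst ij, fst ij) else (snd ij, snd ij)"
    let ?f = "\<lambda>(ij, a) b. if b then if a then decode z u u
      else if fst ij = snd ij then (\<lambda>y. y) else decode z u t else (\<lambda>y. y)"
    show ?thesis
    proof (rule solution_set_is_colimit[OF inf sT sX sV sC, where s = ?s and f = ?f
          and \<pi> = "pair_code z u t"])
      fix q
      assume q: "q \<in> I \<times> I \<rightarrow> T"
        and eq: "\<And>c. c \<in> (I \<times> I) \<times> UNIV \<Longrightarrow>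
          ?f c True (q (?s c True)) = ?f c False (q (?s c False))"
      show "\<exists>!x. x \<in> X \<and> (\<forall>v\<in>I \<times> I. pair_code z u t v x = q v)"
        unfolding I_def
      proof (rule solutions_of_pair_system[OF p d], fold I_def)
        show "q (i, j) \<in> {z, u, t}" if "i \<in> I" "j \<in> I" for i j
          using q that T by auto
        show "decode z u u (q (i, j)) = q (i, i)" if "i \<in> I" "j \<in> I" for i j
          using eq[of "((i, j), True)"] that by simp
        show "decode z u t (q (i, j)) = q (j, j)" if "i \<in> I" "j \<in> I" "i \<noteq> j" for i j
          using eq[of "((i, j), False)"] that by simp
      qed
    next
      show "?s c b \<in> I \<times> I" if "c \<in> (I \<times> I) \<times> UNIV" for c b
        using that by auto
      show "?f c b \<in> T \<rightarrow> T" for c b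
        using T by (auto simp: decode_def split: prod.split)
      show "pair_code z u t v \<in> X \<rightarrow> T" for v
        using T by (auto simp: pair_code_def)
      show "?f c True (pair_code z u t (?s c True) x) =
          ?f c False (pair_code z u t (?s c False) x)" for c x
        using d by (auto simp: pair_code_def decode_def split: prod.split)
    qed
  qed
  with sub sc show ?thesis by (simp add: colimit_dense_def)
qed

end
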